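(* Let $0=t_0<t_1<\cdots<t_N=T$ be a (possibly nonuniform) grid with $\tau_n=t_n-t_{n-1}$, and let $f:[0,\infty)\times\mathbb{R}\to\mathbb{R}$ be smooth with $f(t,\cdot)$ uniformly Lipschitz continuous for $t\in[0,T]$ with Lipschitz constant $M>0$ (i.e. $|f(t,u)-f(t,v)|\le M|u-v|$ for all $t\in[0,T]$, $u,v\in\mathbb{R}$). Let $A=(a_{n-j}^n)$, with $a_{n-j}^n=\bar a_{n-j}^n\tau_j$, be an array kernel that is local R-CMM with range $N$, and assume $M\sup_{1\le j\le N}a_0^j=M\sup_{1\le j\le N}\tau_j\bar a_0^j<1$. For $i=1,2$, given input signals $h^{(i)}$, let $(u^{(i)}_n)$ be the numerical solution of $$u^{(i)}_n=h^{(i)}(t_n)+\sum_{j=1}^n a_{n-j}^n f(t_j,u^{(i)}_j),\qquad 1\le n\le N.$$ Let $\gamma=(\gamma(t_n))_{n\ge1}$ with $\gamma(t_n):=h^{(1)}(t_n)-h^{(2)}(t_n)$. If $r:=\gamma-R_\lambda\bar{*}\gamma\ge 0$ (entrywise, for $1\le n\le N$) for all $\lambda>0$, where $R_\lambda$ is the resolvent kernel of $A$, then $u^{(1)}_n\ge u^{(2)}_n$ for all $1\le n\le N$. In particular, if $h^{(1)}$ and $h^{(2)}$ are two constants with $h^{(1)}\ge h^{(2)}$, then $u^{(1)}_n\ge u^{(2)}_n$ for all $1\le n\le N$.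
   Context: An array kernel $A=(a_{n-j}^n)_{1\le j\le n}$ is a lower triangular real array whose entry in row $n$ and column $j$ is $a_{n-j}^n$ (so $a_0^n$ are the diagonal entries). The pseudo-convolution $C=A\bar{*}B$ of two array kernels is $c_{n-k}^n=\sum_{j=k}^n a_{n-j}^n b_{j-k}^j$ for $1\le k\le n$ (the product of lower triangular matrices); the pseudo-convolution of an array kernel with a vector $x=(x_1,x_2,\dots)$ is $(A\bar{*}x)_n=\sum_{j=1}^n a_{n-j}^n x_j$. Row $n$ of these depends only on rows $\le n$, so finite arrays ($n\le N$) are allowed. $L$ is the array kernel with all entries (on and below the diagonal) equal to $1$. The right complementary kernel $C_R$ of $A$ is the array kernel with $A\bar{*}C_R=L$. An array kernel $A=(a_{n-j}^n)$ is column monotone if its entries are nonnegative and $a_{j-1}^{n-1}\ge a_j^n$ for all $1\le j\le n-1$; it is row monotone if its entries are nonnegative and $a_{j-1}^n\ge a_j^n$ for all $1\le j\le n-1$; it is doubly monotone if it is both. $A$ is local R-CMM (right complementary monotone) with range $N$ if, for rows $n\le N$, $A$ is column monotone and $C_R$ exists and is doubly monotone. For $\lambda>0$ the resolvent kernel $R_\lambda$ of $A$ is the array kernel defined by $R_\lambda+\lambda R_\lambda\bar{*}A=\lambda A$. *)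

theory Defs
  imports "HOL-Analysis.Analysis"
begin

text \<open>
  An array kernel is represented by its matrix entries: \<open>A n j\<close> is the entry
  \<open>a\<^sup>n\<^bsub>n-j\<^esub>\<close> in row \<open>n\<close> and column \<open>j\<close>, so \<open>a\<^sup>n\<^bsub>j\<^esub>\<close> is \<open>A n (n - j)\<close>. Only the entries
  with \<open>1 \<le> j \<le> n\<close> are meaningful; all notions with an argument \<open>N\<close> look only at rows \<open>n \<le> N\<close>.
\<close>

type_synonym array_kernel = "nat \<Rightarrow> nat \<Rightarrow> real"

definition kernel_eq :: "nat \<Rightarrow> array_kernel \<Rightarrow> array_kernel \<Rightarrow> bool" where
  "kernel_eq N A B \<longleftrightarrow> (\<forall>n\<in>{1..N}. \<forall>j\<in>{1..n}. A n j = B n j)"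

definition pconv :: "array_kernel \<Rightarrow> array_kernel \<Rightarrow> array_kernel" where
  "pconv A B = (\<lambda>n k. \<Sum>j=k..n. A n j * B j k)"

definition pconv_vec :: "array_kernel \<Rightarrow> (nat \<Rightarrow> real) \<Rightarrow> nat \<Rightarrow> real" where
  "pconv_vec A x = (\<lambda>n. \<Sum>j=1..n. A n j * x j)"

definition kernel_L :: array_kernel where
  "kernel_L = (\<lambda>n j. 1)"

definition right_complementary :: "nat \<Rightarrow> array_kernel \<Rightarrow> array_kernel \<Rightarrow> bool" where
  "right_complementary N A C \<longleftrightarrow> kernel_eq N (pconv A C) kernel_L"

definition nonneg_kernel :: "nat \<Rightarrow> array_kernel \<Rightarrow> bool" where
  "nonneg_kernel N A \<longleftrightarrow> (\<forall>n\<in>{1..N}. \<forall>j\<in>{1..n}. A n j \<ge> 0)"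

definition column_monotone :: "nat \<Rightarrow> array_kernel \<Rightarrow> bool" where
  "column_monotone N A \<longleftrightarrow> nonneg_kernel N A \<and>
     (\<forall>n\<in>{1..N}. \<forall>j\<in>{1..n - 1}. A (n - 1) (n - j) \<ge> A n (n - j))"

text \<open>Row monotonicity is decrease in the lag \<open>j\<close>, hence increase in the column index.\<close>

definition row_monotone :: "nat \<Rightarrow> array_kernel \<Rightarrow> bool" where
  "row_monotone N A \<longleftrightarrow> nonneg_kernel N A \<and>
     (\<forall>n\<in>{1..N}. \<forall>j\<in>{1..n - 1}. A n (n - (j - 1)) \<ge> A n (n - j))"

definition doubly_monotone :: "nat \<Rightarrow> array_kernel \<Rightarrow> bool" where
  "doubly_monotone N A \<longleftrightarrow> column_monotone N A \<and> row_monotone N A"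

definition local_R_CMM :: "nat \<Rightarrow> array_kernel \<Rightarrow> bool" where
  "local_R_CMM N A \<longleftrightarrow> column_monotone N A \<and>
     (\<exists>C. right_complementary N A C \<and> doubly_monotone N C)"

definition resolvent_kernel :: "nat \<Rightarrow> real \<Rightarrow> array_kernel \<Rightarrow> array_kernel \<Rightarrow> bool" where
  "resolvent_kernel N lam A R \<longleftrightarrow>
     kernel_eq N (\<lambda>n k. R n k + lam * pconv R A n k) (\<lambda>n k. lam * A n k)"

text \<open>
  \<open>C\<^sup>k\<close> and smooth functions on a subset \<open>S\<close> of the plane. Derivatives are taken within \<open>S\<close>;
  on the boundary of the closed half plane they are one-sided in the first variable. The pair
  \<open>(fx, fy)\<close> consists of the two partial derivatives.
\<close>

fun Ck_on :: "nat \<Rightarrow> (real \<times> real) set \<Rightarrow> (real \<times> real \<Rightarrow> real) \<Rightarrow> bool" where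
  "Ck_on 0 S f \<longleftrightarrow> continuous_on S f"
| "Ck_on (Suc k) S f \<longleftrightarrow>
     (\<exists>fx fy. (\<forall>p\<in>S. (f has_derivative (\<lambda>v. fx p * fst v + fy p * snd v)) (at p within S)) \<and>
              Ck_on k S fx \<and> Ck_on k S fy)"

definition smooth_on :: "(real \<times> real) set \<Rightarrow> (real \<times> real \<Rightarrow> real) \<Rightarrow> bool" where
  "smooth_on S f \<longleftrightarrow> (\<forall>k. Ck_on k S f)"

end

theory Submission
  imports Defs
begin

text \<open>
  Subtracting the two schemes and writing the difference of the right-hand sides as \<open>m\<^sub>n w\<^sub>n\<close> with
  \<open>\<bar>m\<^sub>n\<bar> \<le> M\<close> gives the linear equation \<open>w = \<gamma> + A(m w)\<close> for \<open>w = u1 - u2\<close>. Everything rests on the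
  sign pattern of the inverse of \<open>A\<close>. Since \<open>A C = L\<close> and \<open>L\<close> is summation, \<open>A\<^sup>-\<^sup>1 = C \<Delta>\<close> with \<open>\<Delta>\<close> the
  backward difference, and summation by parts turns the row monotonicity of \<open>C\<close> into nonpositive
  off-diagonal entries of \<open>A\<^sup>-\<^sup>1\<close>; its diagonal entries are \<open>C n n = 1 / A n n\<close> and its row sums are
  \<open>C n 1 \<ge> 0\<close>. Hence \<open>A\<^sup>-\<^sup>1 - diag m\<close> still has nonpositive off-diagonal entries, and a positive
  diagonal because \<open>M A n n < 1\<close>, so forward substitution preserves nonnegativity. This is
  \<open>nonneg_of_perturbed_constant\<close>, for equations \<open>x = b + A(m x + \<rho>)\<close> with a constant \<open>b \<ge> 0\<close> and
  \<open>\<rho> \<ge> 0\<close>.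

  Constant signals are the case \<open>x = w\<close>, \<open>\<rho> = 0\<close>. For general signals take \<open>\<lambda> = M\<close>, which
  makes \<open>m + \<lambda>\<close> nonnegative. The vector \<open>r = \<gamma> - R \<gamma>\<close> solves \<open>r + M A r = \<gamma>\<close>
  (\<open>resolvent_remainder_solves\<close>), so \<open>x = w - r\<close> satisfies \<open>x = A(m x + (m + M) r)\<close>. As
  \<open>(m + M) r \<ge> 0\<close>, this is the same situation with \<open>b = 0\<close>, and \<open>w = x + r \<ge> 0\<close>.
\<close>

section \<open>Pseudo-convolution with vectors\<close>

lemma pconv_vec_cong:
  assumes "\<And>j. j \<in> {1..n} \<Longrightarrow> A n j = B n j" "\<And>j. j \<in> {1..n} \<Longrightarrow> x j = y j"
  shows "pconv_vec A x n = pconv_vec B y n"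
  unfolding pconv_vec_def by (rule sum.cong) (use assms in auto)

lemma pconv_vec_add: "pconv_vec A (\<lambda>j. x j + y j) n = pconv_vec A x n + pconv_vec A y n"
  by (simp add: pconv_vec_def sum.distrib algebra_simps)

lemma pconv_vec_diff: "pconv_vec A (\<lambda>j. x j - y j) n = pconv_vec A x n - pconv_vec A y n"
  by (simp add: pconv_vec_def sum_subtractf algebra_simps)

lemma pconv_vec_scale: "pconv_vec A (\<lambda>j. c * x j) n = c * pconv_vec A x n"
  by (simp add: pconv_vec_def sum_distrib_left algebra_simps)

lemma pconv_vec_assoc: "pconv_vec A (pconv_vec B x) n = pconv_vec (pconv A B) x n"
proof -
  have "pconv_vec A (pconv_vec B x) n
      = (\<Sum>j\<in>{1..n}. \<Sum>k\<in>{k\<in>{1..n}. k \<le> j}. A n j * (B j k * x k))"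
    unfolding pconv_vec_def sum_distrib_left
    by (intro sum.cong refl) auto
  also have "\<dots> = (\<Sum>k\<in>{1..n}. \<Sum>j\<in>{j\<in>{1..n}. k \<le> j}. A n j * (B j k * x k))"
    by (rule sum.swap_restrict) auto
  also have "\<dots> = pconv_vec (pconv A B) x n"
    unfolding pconv_vec_def pconv_def sum_distrib_right
    by (intro sum.cong refl) (auto simp: mult.assoc)
  finally show ?thesis .
qed

text \<open>
  A triangular system whose diagonal entries do not vanish has only the zero solution. The
  diagonal shift \<open>d\<close> covers both the kernel itself (\<open>d = 0\<close>) and the identity minus the kernel
  (\<open>d = 1\<close>).
\<close>

lemma triangular_system_unique:
  assumes eq: "\<And>n. n \<in> {1..N} \<Longrightarrow> pconv_vec G e n = d * e n"
    and diag: "\<And>n. n \<in> {1..N} \<Longrightarrow> G n n \<noteq> d"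
    and "n \<in> {1..N}"
  shows "e n = 0"
  using \<open>n \<in> {1..N}\<close>
proof (induction n rule: less_induct)
  case (less n)
  then obtain m where m: "n = Suc m" by (cases n) auto
  have "(\<Sum>j=1..m. G n j * e j) = 0"
    by (rule sum.neutral) (use less m in auto)
  then have "pconv_vec G e n = G n n * e n"
    by (simp add: pconv_vec_def m)
  then have "(G n n - d) * e n = 0"
    using eq[OF less.prems] unfolding left_diff_distrib by linarith
  then show ?case using diag[OF less.prems] by simp
qed

section \<open>Inverting a kernel through its right complementary kernel\<close>

text \<open>
  The value before the first index counts as zero, so that differencing inverts summation
  from index \<open>1\<close> exactly.
\<close>

definition backward_diff :: "(nat \<Rightarrow> real) \<Rightarrow> nat \<Rightarrow> real" where
  "backward_diff x k = x k - (if k = 1 then 0 else x (k - 1))"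

lemma summation_by_parts:
  "(\<Sum>k=1..Suc m. c k * backward_diff x k)
     = c (Suc m) * x (Suc m) + (\<Sum>k=1..m. (c k - c (Suc k)) * x k)"
  by (induction m) (simp_all add: backward_diff_def algebra_simps)

lemma pconv_vec_L_backward_diff:
  assumes "n \<ge> 1"
  shows "pconv_vec kernel_L (backward_diff x) n = x n"
proof -
  obtain m where "n = Suc m" using assms by (cases n) auto
  then show ?thesis
    using summation_by_parts[of "\<lambda>_. 1" x m] by (simp add: pconv_vec_def kernel_L_def)
qed

lemma right_complementary_diag:
  assumes "right_complementary N A C" "n \<in> {1..N}"
  shows "A n n * C n n = 1"
  using assms
  unfolding right_complementary_def kernel_eq_def pconv_def kernel_L_def
  by (metis (no_types, lifting) atLeastAtMost_iff atLeastAtMost_singleton order_refl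
      sum.empty sum.insert add_0_right finite.emptyI empty_iff)

text \<open>
  In operator form \<open>A\<^sup>-\<^sup>1 = C \<Delta>\<close>: because \<open>A C\<close> sums and \<open>\<Delta>\<close> undoes summation, \<open>C \<Delta> x\<close> and \<open>q\<close> have
  the same image \<open>x\<close> under \<open>A\<close>, which is injective.
\<close>

lemma right_complementary_inverts:
  assumes C: "right_complementary N A C"
    and x: "\<And>n. n \<in> {1..N} \<Longrightarrow> x n = pconv_vec A q n"
    and n: "n \<in> {1..N}"
  shows "q n = pconv_vec C (backward_diff x) n"
proof -
  have "pconv_vec C (backward_diff x) n - q n = 0"
  proof (rule triangular_system_unique[OF _ _ n, where d = 0 and G = A])
    fix i assume i: "i \<in> {1..N}"
    have "pconv_vec A (pconv_vec C (backward_diff x)) i = pconv_vec kernel_L (backward_diff x) i"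
      unfolding pconv_vec_assoc
      by (rule pconv_vec_cong) (use C i in \<open>auto simp: right_complementary_def kernel_eq_def\<close>)
    also have "\<dots> = pconv_vec A q i"
      using pconv_vec_L_backward_diff[of i x] x[OF i] i by simp
    finally show "pconv_vec A (\<lambda>n. pconv_vec C (backward_diff x) n - q n) i
        = 0 * (pconv_vec C (backward_diff x) i - q i)"
      by (simp add: pconv_vec_diff)
    show "A i i \<noteq> 0"
      using right_complementary_diag[OF C i] by auto
  qed
  then show ?thesis by simp
qed

lemma row_monotone_step:
  assumes "row_monotone N C" "n \<in> {1..N}" "k \<in> {1..<n}"
  shows "C n k \<le> C n (Suc k)"
proof -
  have "n - k \<in> {1..n - 1}" and *: "n - (n - k) = k" "n - (n - k - 1) = Suc k"
    using assms(3) by auto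
  then have "C n (n - (n - k)) \<le> C n (n - (n - k - 1))"
    using assms(1,2) unfolding row_monotone_def by blast
  then show ?thesis unfolding * .
qed

text \<open>
  Applying \<open>C \<Delta>\<close> to \<open>x - b = A(m x + \<rho>)\<close> gives, in row \<open>n\<close>,
  \<open>(C n n - m n) x\<^sub>n = \<rho>\<^sub>n + b C n 1 + \<Sum>\<^bsub>k<n\<^esub> (C n (k + 1) - C n k) x\<^sub>k\<close>. Every coefficient on the right
  is nonnegative and the factor on the left is positive, so nonnegativity propagates from the
  earlier rows to \<open>x\<^sub>n\<close>.
\<close>

lemma nonneg_of_perturbed_constant:
  assumes C: "right_complementary N A C" and row: "row_monotone N C"
    and A: "nonneg_kernel N A"
    and "b \<ge> 0"
    and x: "\<And>n. n \<in> {1..N} \<Longrightarrow> x n = b + pconv_vec A (\<lambda>j. m j * x j + \<rho> j) n"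
    and m: "\<And>n. n \<in> {1..N} \<Longrightarrow> m n * A n n < 1"
    and \<rho>: "\<And>n. n \<in> {1..N} \<Longrightarrow> \<rho> n \<ge> 0"
    and "n \<in> {1..N}"
  shows "x n \<ge> 0"
  using \<open>n \<in> {1..N}\<close>
proof (induction n rule: less_induct)
  case (less n)
  note n = less.prems
  then obtain i where i: "n = Suc i" by (cases n) auto
  have telescope: "c (Suc i) + (\<Sum>k=1..i. c k - c (Suc k)) = c 1" for c :: "nat \<Rightarrow> real"
    by (induction i) simp_all
  have "m n * x n + \<rho> n = pconv_vec C (backward_diff (\<lambda>j. x j - b)) n"
    by (rule right_complementary_inverts[OF C _ n]) (simp add: x)
  also have "\<dots> = C n n * (x n - b) + (\<Sum>k=1..i. (C n k - C n (Suc k)) * (x k - b))"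
    using summation_by_parts[of "C n" "\<lambda>j. x j - b" i] by (simp add: pconv_vec_def i)
  also have "\<dots> = C n n * x n - (\<Sum>k=1..i. (C n (Suc k) - C n k) * x k)
      - b * (C n n + (\<Sum>k=1..i. C n k - C n (Suc k)))"
    by (simp add: sum_distrib_left sum.distrib sum_subtractf algebra_simps)
  also have "C n n + (\<Sum>k=1..i. C n k - C n (Suc k)) = C n 1"
    using telescope[of "C n"] by (simp add: i)
  finally have "(C n n - m n) * x n = \<rho> n + b * C n 1 + (\<Sum>k=1..i. (C n (Suc k) - C n k) * x k)"
    by (simp add: algebra_simps)
  also have "\<dots> \<ge> 0"
  proof (intro add_nonneg_nonneg mult_nonneg_nonneg sum_nonneg)
    show "C n 1 \<ge> 0"
      using row n by (auto simp: row_monotone_def nonneg_kernel_def)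
    fix k assume k: "k \<in> {1..i}"
    then show "C n (Suc k) - C n k \<ge> 0"
      using row_monotone_step[OF row n, of k] i by auto
    show "x k \<ge> 0"
      using less.IH[of k] k n i by auto
  qed (use \<rho> n \<open>b \<ge> 0\<close> in auto)
  finally have *: "(C n n - m n) * x n \<ge> 0" .
  have "A n n * C n n = 1" using right_complementary_diag[OF C n] .
  moreover have "A n n \<ge> 0" using A n by (auto simp: nonneg_kernel_def)
  ultimately have "C n n > m n"
    using m[OF n] by (smt (verit) mult.commute mult_left_mono)
  then show ?case using * by (simp add: zero_le_mult_iff)
qed

section \<open>Resolvent kernels\<close>

text \<open>
  The defining equation of the resolvent kernel, solved for \<open>R n k\<close> within row \<open>n\<close> by backward
  substitution from the diagonal \<open>k = n\<close> down to \<open>k = 1\<close>.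
\<close>

function resolvent :: "real \<Rightarrow> array_kernel \<Rightarrow> array_kernel" where
  "resolvent lam A n k =
     (lam * A n k - lam * (\<Sum>j\<in>{Suc k..n}. resolvent lam A n j * A j k)) / (1 + lam * A k k)"
  by pat_completeness auto
termination
  by (relation "Wellfounded.measure (\<lambda>(lam, A, n, k). n - k)") auto

declare resolvent.simps [simp del]

lemma resolvent_kernel_resolvent:
  assumes "\<And>n. n \<in> {1..N} \<Longrightarrow> 1 + lam * A n n \<noteq> 0"
  shows "resolvent_kernel N lam A (resolvent lam A)"
  unfolding resolvent_kernel_def kernel_eq_def pconv_def
proof (intro ballI)
  fix n k assume nk: "n \<in> {1..N}" "k \<in> {1..n}"
  let ?R = "resolvent lam A"
  have "1 + lam * A k k \<noteq> 0" using assms[of k] nk by auto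
  then have "?R n k * (1 + lam * A k k)
      = lam * A n k - lam * (\<Sum>j\<in>{Suc k..n}. ?R n j * A j k)"
    by (subst resolvent.simps) simp
  moreover have "(\<Sum>j=k..n. ?R n j * A j k)
      = ?R n k * A k k + (\<Sum>j\<in>{Suc k..n}. ?R n j * A j k)"
    using nk by (simp add: sum.atLeast_Suc_atMost)
  ultimately show "?R n k + lam * (\<Sum>j=k..n. ?R n j * A j k) = lam * A n k"
    by (simp add: algebra_simps)
qed

lemma resolvent_kernel_vec:
  assumes "resolvent_kernel N lam A R" "n \<in> {1..N}"
  shows "pconv_vec R x n + lam * pconv_vec R (pconv_vec A x) n = lam * pconv_vec A x n"
proof -
  have "pconv_vec R x n + lam * pconv_vec R (pconv_vec A x) n
      = pconv_vec (\<lambda>n k. R n k + lam * pconv R A n k) x n"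
    unfolding pconv_vec_assoc
    by (simp add: pconv_vec_def sum.distrib sum_distrib_left algebra_simps)
  also have "\<dots> = pconv_vec (\<lambda>n k. lam * A n k) x n"
    by (rule pconv_vec_cong)
      (use assms in \<open>auto simp: resolvent_kernel_def kernel_eq_def\<close>)
  finally show ?thesis
    by (simp add: pconv_vec_def sum_distrib_left algebra_simps)
qed

text \<open>
  The resolvent equation says that \<open>I - R\<close> is a left inverse of \<open>I + \<lambda>A\<close>; what is needed is that it
  is also a right inverse. Set \<open>s = (I + \<lambda>A) r\<close> for \<open>r = (I - R) \<gamma>\<close>. Then \<open>(I - R) s = r = (I - R) \<gamma>\<close>,
  and \<open>I - R\<close> is injective because its diagonal entries \<open>1 / (1 + \<lambda> A n n)\<close> do not vanish.
\<close>

lemma resolvent_remainder_solves: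
  assumes R: "resolvent_kernel N lam A R" and n: "n \<in> {1..N}"
  shows "(\<gamma> n - pconv_vec R \<gamma> n) + lam * pconv_vec A (\<lambda>j. \<gamma> j - pconv_vec R \<gamma> j) n = \<gamma> n"
proof -
  define r where "r = (\<lambda>n. \<gamma> n - pconv_vec R \<gamma> n)"
  define e where "e = (\<lambda>n. r n + lam * pconv_vec A r n - \<gamma> n)"
  have "e n = 0"
  proof (rule triangular_system_unique[OF _ _ n, where d = 1 and G = R])
    fix i assume i: "i \<in> {1..N}"
    have "pconv_vec R e i
        = pconv_vec R r i + lam * pconv_vec R (pconv_vec A r) i - pconv_vec R \<gamma> i"
      unfolding e_def by (simp add: pconv_vec_diff pconv_vec_add pconv_vec_scale)
    also have "\<dots> = lam * pconv_vec A r i - pconv_vec R \<gamma> i"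
      using resolvent_kernel_vec[OF R i, of r] by simp
    also have "\<dots> = e i"
      by (simp add: e_def r_def)
    finally show "pconv_vec R e i = 1 * e i" by simp
    have "R i i + lam * (R i i * A i i) = lam * A i i"
      using R[unfolded resolvent_kernel_def kernel_eq_def pconv_def, rule_format, of i i] i
      by simp
    then show "R i i \<noteq> 1" by auto
  qed
  then show ?thesis by (simp add: e_def r_def)
qed

section \<open>The comparison principle\<close>

lemma lipschitz_multiplier:
  fixes F :: "'i \<Rightarrow> real \<Rightarrow> real"
  assumes "\<And>j. j \<in> I \<Longrightarrow> M-lipschitz_on UNIV (F j)" "M \<ge> 0"
  obtains m where "\<And>j. j \<in> I \<Longrightarrow> F j (x j) - F j (y j) = m j * (x j - y j)"
    and "\<And>j. j \<in> I \<Longrightarrow> \<bar>m j\<bar> \<le> M"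
proof
  \<comment> \<open>Where the arguments coincide, division by zero gives the multiplier \<open>0\<close>.\<close>
  let ?m = "\<lambda>j. (F j (x j) - F j (y j)) / (x j - y j)"
  fix j assume "j \<in> I"
  show "F j (x j) - F j (y j) = ?m j * (x j - y j)"
    by (cases "x j = y j") auto
  have "\<bar>F j (x j) - F j (y j)\<bar> \<le> M * \<bar>x j - y j\<bar>"
    using lipschitz_onD[OF assms(1)[OF \<open>j \<in> I\<close>], of "x j" "y j"] by (simp add: dist_real_def)
  then show "\<bar>?m j\<bar> \<le> M"
    using \<open>M \<ge> 0\<close> by (cases "x j = y j") (auto simp: abs_divide divide_le_eq)
qed

theorem theorem5p1:
  fixes N :: nat and T M :: real
    and t \<tau> :: "nat \<Rightarrow> real"
    and f :: "real \<Rightarrow> real \<Rightarrow> real"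
    and A Abar :: array_kernel
    and h1 h2 :: "real \<Rightarrow> real"
    and u1 u2 \<gamma> :: "nat \<Rightarrow> real"
  assumes "N \<ge> 1"
    and "t 0 = 0" and "\<And>n. n < N \<Longrightarrow> t n < t (Suc n)" and "t N = T"
    and "\<And>n. n \<in> {1..N} \<Longrightarrow> \<tau> n = t n - t (n - 1)"
    and "smooth_on ({0..} \<times> UNIV) (\<lambda>(s, v). f s v)"
    and "M > 0"
    and "\<And>s. s \<in> {0..T} \<Longrightarrow> M-lipschitz_on UNIV (f s)"
    and "\<And>n j. n \<in> {1..N} \<Longrightarrow> j \<in> {1..n} \<Longrightarrow> A n j = Abar n j * \<tau> j"
    and "local_R_CMM N A"
    and "M * (SUP j\<in>{1..N}. A j j) < 1"
    and "\<And>n. n \<in> {1..N} \<Longrightarrow> u1 n = h1 (t n) + pconv_vec A (\<lambda>j. f (t j) (u1 j)) n"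
    and "\<And>n. n \<in> {1..N} \<Longrightarrow> u2 n = h2 (t n) + pconv_vec A (\<lambda>j. f (t j) (u2 j)) n"
    and "\<And>n. n \<in> {1..N} \<Longrightarrow> \<gamma> n = h1 (t n) - h2 (t n)"
  shows "((\<forall>lam>0. \<forall>R. resolvent_kernel N lam A R \<longrightarrow>
             (\<forall>n\<in>{1..N}. \<gamma> n - pconv_vec R \<gamma> n \<ge> 0))
           \<longrightarrow> (\<forall>n\<in>{1..N}. u1 n \<ge> u2 n)) \<and>
         (\<forall>c1 c2. (\<forall>s\<ge>0. h1 s = c1) \<and> (\<forall>s\<ge>0. h2 s = c2) \<and> c1 \<ge> c2
           \<longrightarrow> (\<forall>n\<in>{1..N}. u1 n \<ge> u2 n))"
proof -
  note t_step = assms(3) and A_CMM = assms(10) and small = assms(11)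
  note u1 = assms(12) and u2 = assms(13) and \<gamma> = assms(14)
  have M: "M \<ge> 0" using assms(7) by simp
  have A: "nonneg_kernel N A"
    using A_CMM by (simp add: local_R_CMM_def column_monotone_def)
  obtain C where C: "right_complementary N A C" and row: "row_monotone N C"
    using A_CMM by (auto simp: local_R_CMM_def doubly_monotone_def)

  have t_mono: "t i \<le> t j" if "i \<le> j" "j \<le> N" for i j
    using that
  proof (induction j rule: dec_induct)
    case (step j)
    then show ?case using t_step[of j] by simp
  qed simp
  have t_nonneg: "t j \<ge> 0" if "j \<in> {1..N}" for j
    using t_mono[of 0 j] that assms(2) by simp
  have t_range: "t j \<in> {0..T}" if "j \<in> {1..N}" for j
    using t_nonneg[OF that] t_mono[of j N] that assms(4) by simp

  obtain m where m: "\<And>j. j \<in> {1..N} \<Longrightarrow> f (t j) (u1 j) - f (t j) (u2 j) = m j * (u1 j - u2 j)"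
    and m_bound: "\<And>j. j \<in> {1..N} \<Longrightarrow> \<bar>m j\<bar> \<le> M"
    using lipschitz_multiplier[of "{1..N}" M "\<lambda>j. f (t j)" u1 u2] assms(8) t_range M by blast
  define w where "w = (\<lambda>n. u1 n - u2 n)"
  have w: "w n = \<gamma> n + pconv_vec A (\<lambda>j. m j * w j) n" if n: "n \<in> {1..N}" for n
  proof -
    have "w n = \<gamma> n + pconv_vec A (\<lambda>j. f (t j) (u1 j) - f (t j) (u2 j)) n"
      using u1[OF n] u2[OF n] \<gamma>[OF n] by (simp add: w_def pconv_vec_diff)
    also have "pconv_vec A (\<lambda>j. f (t j) (u1 j) - f (t j) (u2 j)) n
        = pconv_vec A (\<lambda>j. m j * w j) n"
      by (rule pconv_vec_cong) (use m n in \<open>auto simp: w_def\<close>)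
    finally show ?thesis .
  qed
  have diag: "m n * A n n < 1" if n: "n \<in> {1..N}" for n
  proof -
    have "A n n \<ge> 0" using A n by (auto simp: nonneg_kernel_def)
    then have "m n * A n n \<le> M * A n n"
      using m_bound[OF n] by (intro mult_right_mono) auto
    also have "\<dots> \<le> M * (SUP j\<in>{1..N}. A j j)"
      using M n by (intro mult_left_mono cSUP_upper) auto
    finally show ?thesis using small by simp
  qed

  show ?thesis
  proof (intro conjI impI allI ballI)
    fix n
    assume r_nonneg: "\<forall>lam>0. \<forall>R. resolvent_kernel N lam A R \<longrightarrow>
        (\<forall>n\<in>{1..N}. \<gamma> n - pconv_vec R \<gamma> n \<ge> 0)"
      and n: "n \<in> {1..N}"
    have "1 + M * A n n \<noteq> 0" if "n \<in> {1..N}" for n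
    proof -
      have "M * A n n \<ge> 0" using M A that by (auto simp: nonneg_kernel_def)
      then show ?thesis by simp
    qed
    then have R: "resolvent_kernel N M A (resolvent M A)"
      by (rule resolvent_kernel_resolvent)
    define r where "r = (\<lambda>n. \<gamma> n - pconv_vec (resolvent M A) \<gamma> n)"
    have r: "r i \<ge> 0" if "i \<in> {1..N}" for i
      using r_nonneg R assms(7) that by (auto simp: r_def)
    have "w n - r n \<ge> 0"
    proof (rule nonneg_of_perturbed_constant[OF C row A, where b = 0 and m = m
          and \<rho> = "\<lambda>j. (m j + M) * r j"])
      fix i assume i: "i \<in> {1..N}"
      \<comment> \<open>The resolvent identity \<open>\<gamma> - r = M A r\<close> moves the whole inhomogeneity under \<open>A\<close>.\<close>
      have "w i - r i = pconv_vec A (\<lambda>j. m j * w j) i + M * pconv_vec A r i"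
        using w[OF i] resolvent_remainder_solves[OF R i, of \<gamma>] unfolding r_def by simp
      also have "\<dots> = pconv_vec A (\<lambda>j. m j * w j + M * r j) i"
        by (simp add: pconv_vec_add pconv_vec_scale)
      also have "\<dots> = pconv_vec A (\<lambda>j. m j * (w j - r j) + (m j + M) * r j) i"
        by (rule pconv_vec_cong) (simp_all add: algebra_simps)
      finally show "w i - r i = 0 + pconv_vec A (\<lambda>j. m j * (w j - r j) + (m j + M) * r j) i"
        by simp
      show "(m i + M) * r i \<ge> 0"
        using r[OF i] m_bound[OF i] by (intro mult_nonneg_nonneg) auto
    qed (use diag n in auto)
    then show "u1 n \<ge> u2 n"
      using r[OF n] by (simp add: w_def)
  next
    fix c1 c2 n
    assume c: "(\<forall>s\<ge>0. h1 s = c1) \<and> (\<forall>s\<ge>0. h2 s = c2) \<and> c1 \<ge> c2" and n: "n \<in> {1..N}"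
    have "w n \<ge> 0"
    proof (rule nonneg_of_perturbed_constant[OF C row A, where b = "c1 - c2" and m = m
          and \<rho> = "\<lambda>j. 0"])
      fix i assume i: "i \<in> {1..N}"
      have "\<gamma> i = c1 - c2" using c \<gamma>[OF i] t_nonneg[OF i] by simp
      then show "w i = c1 - c2 + pconv_vec A (\<lambda>j. m j * w j + 0) i"
        using w[OF i] by simp
    qed (use diag n c in auto)
    then show "u1 n \<ge> u2 n" by (simp add: w_def)
  qed
qed

end
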